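(* Every online algorithm for the simple unbounded knapsack problem that uses one uniformly random bit (and no other randomness) has competitive ratio in expectation at least $2$.
   Context: Online simple unbounded knapsack problem: knapsack capacity $1$; an instance is a sequence of items $x_1,\dots,x_n$ ($n$ unknown to the algorithm) with sizes $s_i\in[0,1]$ and values $v_i=s_i$. Items arrive one by one; upon arrival of $x_i$ the algorithm irrevocably chooses a number $k_i\in\mathbb{N}_0$ of copies to pack, with the total packed size never exceeding $1$. $\mathrm{opt}(I)=\max\{\sum_i k_i v_i: k_i\in\mathbb{N}_0,\sum_i k_i s_i\le1\}$. For a randomized algorithm, $\mathrm{gain}(I)$ is the expected total packed value, the competitive ratio in expectation on $I$ is $\mathrm{opt}(I)/\mathrm{gain}(I)$, and the competitive ratio in expectation of the algorithm is the supremum of this over all instances. *)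

theory Defs
  imports "HOL-Probability.Probability"
begin

text \<open>
  Every item has value equal to its size, so an instance is represented by the list of its item
  sizes. An item may be packed several times; a packing is given by the number of copies
  \<^term>\<open>k i\<close> of the \<^term>\<open>i\<close>-th item (counting from 0), and its total size and total value coincide.
\<close>

definition knapsack_instance :: "real list \<Rightarrow> bool" where
  "knapsack_instance I \<longleftrightarrow> set I \<subseteq> {0..1}"

definition total :: "(nat \<Rightarrow> nat) \<Rightarrow> real list \<Rightarrow> real" where
  "total k I = (\<Sum>i<length I. real (k i) * I ! i)"

definition opt :: "real list \<Rightarrow> real" where
  "opt I = Max {total k I | k. total k I \<le> 1}"

text \<open>The maximum in \<^const>\<open>opt\<close> is over a finite nonempty set, hence attained.\<close>

lemma finite_packings:
  assumes "knapsack_instance I"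
  shows "finite {total k I | k. total k I \<le> 1}"
proof (rule finite_subset)
  let ?K = "PiE {..<length I} (\<lambda>i. {..nat \<lfloor>1 / I ! i\<rfloor>})"
  show "finite ((\<lambda>k. total k I) ` ?K)"
    by (intro finite_imageI finite_PiE) auto
  show "{total k I | k. total k I \<le> 1} \<subseteq> (\<lambda>k. total k I) ` ?K"
  proof clarify
    fix k assume le: "total k I \<le> 1"
    have nonneg: "I ! i \<ge> 0" if "i < length I" for i
      using assms subsetD[OF _ nth_mem[OF that], of "{0..1}"] by (simp add: knapsack_instance_def)
    define k' where "k' = restrict (\<lambda>i. if I ! i = 0 then 0 else k i) {..<length I}"
    have "total k I = total k' I"
      unfolding total_def k'_def by (intro sum.cong) auto
    moreover have "k i \<le> nat \<lfloor>1 / I ! i\<rfloor>" if i: "i < length I" and nz: "I ! i \<noteq> 0" for i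
    proof -
      have "real (k i) * I ! i \<le> total k I"
        unfolding total_def
        by (rule member_le_sum[where f = "\<lambda>i. real (k i) * I ! i"]) (use i nonneg in auto)
      then have "real (k i) \<le> 1 / I ! i"
        using le nonneg[OF i] nz by (simp add: field_simps)
      then show ?thesis
        by (simp add: le_nat_floor)
    qed
    then have "k' \<in> ?K"
      by (auto simp: k'_def)
    ultimately show "total k I \<in> (\<lambda>k. total k I) ` ?K"
      by blast
  qed
qed

lemma packings_nonempty: "{total k I | k. total k I \<le> 1} \<noteq> {}"
proof -
  have "total (\<lambda>_. 0) I \<le> 1"
    by (simp add: total_def)
  then show ?thesis
    by blast
qed

text \<open>
  A deterministic online strategy maps the nonempty list of items seen so far, the last of which is
  the item to be decided, to the number of copies of that last item. Its earlier decisions are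
  functions of the same list, so they need not be passed separately.
\<close>

definition packed :: "(real list \<Rightarrow> nat) \<Rightarrow> real list \<Rightarrow> real" where
  "packed f I = total (\<lambda>i. f (take (Suc i) I)) I"

text \<open>
  Prefixes of instances are instances, so the capacity is respected after every single item.
\<close>

definition online_strategy :: "(real list \<Rightarrow> nat) \<Rightarrow> bool" where
  "online_strategy f \<longleftrightarrow> (\<forall>I. knapsack_instance I \<longrightarrow> packed f I \<le> 1)"

text \<open>
  An algorithm with one random bit has type \<^typ>\<open>bool \<Rightarrow> real list \<Rightarrow> nat\<close>; once the bit is
  fixed, it is a deterministic strategy.
\<close>

definition one_bit_algorithm :: "(bool \<Rightarrow> real list \<Rightarrow> nat) \<Rightarrow> bool" where
  "one_bit_algorithm A \<longleftrightarrow> (\<forall>b. online_strategy (A b))"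

definition gain :: "(bool \<Rightarrow> real list \<Rightarrow> nat) \<Rightarrow> real list \<Rightarrow> real" where
  "gain A I = measure_pmf.expectation (pmf_of_set (UNIV :: bool set)) (\<lambda>b. packed (A b) I)"

text \<open>
  The ratio is \<^term>\<open>\<infinity> :: ennreal\<close> if only the gain is zero. If the optimum is zero as well, it is
  \<^term>\<open>0 :: ennreal\<close>, so such instances do not affect the supremum.
\<close>

definition competitive_ratio :: "(bool \<Rightarrow> real list \<Rightarrow> nat) \<Rightarrow> ennreal" where
  "competitive_ratio A = (SUP I \<in> {I. knapsack_instance I}. ennreal (opt I) / ennreal (gain A I))"

end

theory Submission
  imports Defs
begin

text \<open>
  A first item of size slightly above \<open>1/2\<close> must be packed under both values of the bit, since
  otherwise the gain is at most half of it. Then nothing remains for a second item of size \<open>1\<close>.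
\<close>

lemma total_le_opt:
  assumes "knapsack_instance I" and "total k I \<le> 1"
  shows "total k I \<le> opt I"
  unfolding opt_def using assms by (intro Max_ge finite_packings) auto

lemma gain_eq: "gain A I = (packed (A True) I + packed (A False) I) / 2"
  by (simp add: gain_def integral_pmf_of_set UNIV_bool add.commute)

lemma packed_nonneg:
  assumes "knapsack_instance I"
  shows "packed f I \<ge> 0"
  unfolding packed_def total_def
proof (intro sum_nonneg mult_nonneg_nonneg)
  fix i assume "i \<in> {..<length I}"
  then show "0 \<le> I ! i"
    using assms subsetD[OF _ nth_mem[of i I], of "{0..1}"] by (simp add: knapsack_instance_def)
qed simp

text \<open>Stating the bound as a product also covers zero gain: there the ratio is
  \<open>\<infinity>\<close>, because the optimum is positive.\<close>

lemma competitive_ratio_ge: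
  assumes I: "knapsack_instance I" and c: "c \<ge> 0"
    and le: "c * gain A I \<le> opt I" and pos: "opt I > 0"
  shows "ennreal c \<le> competitive_ratio A"
proof -
  have gain: "gain A I \<ge> 0"
    using packed_nonneg[OF I] by (simp add: gain_eq)
  have "ennreal c \<le> ennreal (opt I) / ennreal (gain A I)"
  proof (cases "gain A I = 0")
    case True
    then show ?thesis
      using pos by simp
  next
    case False
    with gain le pos show ?thesis
      by (simp add: divide_ennreal ennreal_leI field_simps)
  qed
  also have "\<dots> \<le> competitive_ratio A"
    unfolding competitive_ratio_def using I by (intro SUP_upper) auto
  finally show ?thesis .
qed

lemma packed_single: "packed f [s] = real (f [s]) * s"
  by (simp add: packed_def total_def)

lemma packed_pair: "packed f [s, t] = real (f [s]) * s + real (f [s, t]) * t"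
  by (simp add: packed_def total_def)

theorem theorem2:
  fixes A :: "bool \<Rightarrow> real list \<Rightarrow> nat"
  assumes "one_bit_algorithm A"
  shows "competitive_ratio A \<ge> 2"
proof (rule dense_le_bounded)
  show "(1 :: ennreal) < 2"
    by simp
next
  \<comment> \<open>The first item must be larger than 1/2, so the ratio forced when both bits pack
    it stays below 2. Hence 2 is only approached, through every \<open>w\<close> strictly between 1
    and 2.\<close>
  fix w :: ennreal
  assume w: "1 < w" "w < 2"
  then obtain c where c: "w = ennreal c" "1 < c" "c < 2"
    by (cases w) (auto simp flip: ennreal_1 ennreal_numeral simp: ennreal_less_iff)
  \<comment> \<open>With this size, gain \<open>s\<close> against optimum 1 gives ratio exactly
    \<open>c\<close>; \<open>c < 2\<close> makes two copies exceed the capacity.\<close>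
  define s where "s = 1 / c"
  have s: "1/2 < s" "s < 1" "c * s = 1"
    using c by (auto simp: s_def field_simps)
  have inst: "knapsack_instance [s]" "knapsack_instance [s, 1]"
    using s by (auto simp: knapsack_instance_def)
  have cap: "packed (A b) I \<le> 1" if "knapsack_instance I" for b I
    using assms that by (auto simp: one_bit_algorithm_def online_strategy_def)
  have k: "A b [s] \<le> 1" for b
  proof (rule ccontr)
    assume "\<not> A b [s] \<le> 1"
    then have "2 * s \<le> real (A b [s]) * s"
      using s by (intro mult_right_mono) auto
    then show False
      using cap[OF inst(1), of b] s(1) unfolding packed_single by linarith
  qed
  show "w \<le> competitive_ratio A"
  proof (cases "\<forall>b. A b [s] = 1")
    case True
    \<comment> \<open>Any copy of the second item would bring the load to at least
      \<open>s + 1 > 1\<close>.\<close>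
    have "packed (A b) [s, 1] = s" for b
      using cap[OF inst(2), of b] s True by (cases "A b [s, 1]") (auto simp: packed_pair)
    then have "gain A [s, 1] = s"
      by (simp add: gain_eq)
    \<comment> \<open>The witness \<open>\<lambda>i. i\<close> takes no copy of item 0 and one copy
      of item 1.\<close>
    moreover have "1 \<le> opt [s, 1]"
      using total_le_opt[OF inst(2), of "\<lambda>i. i"] by (simp add: total_def)
    ultimately show ?thesis
      unfolding c(1) using s c inst(2) by (intro competitive_ratio_ge) auto
  next
    case False
    then obtain b where "A b [s] = 0"
      using k by (metis le_neq_implies_less less_one)
    \<comment> \<open>The other bit value packs at most one copy, so the average over both is at
      most \<open>s / 2\<close>.\<close>
    moreover have "real (A (\<not> b) [s]) * s \<le> 1 * s"
      using k[of "\<not> b"] s by (intro mult_right_mono) auto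
    ultimately have "gain A [s] \<le> s / 2"
      by (cases b) (auto simp: gain_eq packed_single)
    then have "c * gain A [s] \<le> c * (s / 2)"
      using c by (intro mult_left_mono) auto
    moreover have "s \<le> opt [s]"
      using total_le_opt[OF inst(1), of "\<lambda>_. 1"] s by (simp add: total_def)
    \<comment> \<open>As \<open>c * s = 1\<close>, the bound \<open>c * (s / 2)\<close> equals 1/2,
      which is below \<open>s\<close>.\<close>
    ultimately show ?thesis
      unfolding c(1) using s c inst(1) by (intro competitive_ratio_ge) auto
  qed
qed

end
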